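(* Let $Z=(Z_n)_{n\ge 1}$ be an aperiodic, irreducible, time homogeneous Markov chain on a finite state space $\mathcal{S}$, with initial distribution $\mu$, transition matrix $P$ and stationary distribution $\pi$. Let each $Z_n$, $n\ge 1$, generate a pair $(X_n,Y_n)$ according to a distribution associated to the state of $Z_n$, i.e., let $(Z,(X,Y))$ be a hidden Markov model, where $X=(X_n)_{n\ge1}$ and $Y=(Y_n)_{n\ge1}$. Suppose that all $X_i$, $i\ge1$, and all $Y_j$, $j\ge 1$, take their values in a common finite alphabet $\mathcal{A}$, and that there exists $a\in\mathcal{A}$ such that $\mathbb{P}(X_i=Y_j=a)>0$ for some $i\ge1$ and $j\ge1$. Then $$\lim_{n\to\infty}\frac{\mathbb{E}[LC_n]}{n}=\gamma^*$$ for some $\gamma^*\in(0,1]$.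
   Context: Hidden Markov model: $(Z,(X,Y))$ is a hidden Markov model if $Z$ is a Markov chain (the latent chain) and, given $Z$, the pairs $(X_n,Y_n)$, $n\ge1$, are conditionally independent, the conditional law of $(X_n,Y_n)$ depending only on the state $Z_n$, through an emission distribution on $\mathcal{A}\times\mathcal{A}$ associated with that state and not depending on $n$. ($X_n$ and $Y_n$ need not be conditionally independent of each other.) $LC_n$ denotes the length of the longest common subsequences of $X_1,\ldots,X_n$ and $Y_1,\ldots,Y_n$, i.e., the largest $k\ge 0$ such that there exist $1\le i_1<\cdots<i_k\le n$ and $1\le j_1<\cdots<j_k\le n$ with $X_{i_s}=Y_{j_s}$ for all $s=1,\ldots,k$. *)

theory Defs
  imports "HOL-Probability.Probability"
begin

section \<open>Finite Markov chains\<close>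

text \<open>
  Finite state spaces and alphabets are types of class \<^class>\<open>finite\<close> with the discrete sigma-algebra
  \<open>count_space UNIV\<close>. Processes \<open>nat \<Rightarrow> 'w \<Rightarrow> _\<close> are indexed by \<open>n \<ge> 1\<close>; nothing is
  required of their value at index \<open>0\<close>.
\<close>

definition stochastic_matrix :: "real^'s^'s \<Rightarrow> bool" where
  "stochastic_matrix P \<longleftrightarrow> (\<forall>i j. 0 \<le> P $ i $ j) \<and> (\<forall>i. (\<Sum>j\<in>UNIV. P $ i $ j) = 1)"

definition matrix_power :: "real^'s^'s \<Rightarrow> nat \<Rightarrow> real^'s^'s" where
  "matrix_power P n = (((**) P) ^^ n) (mat 1)"

definition irreducible_matrix :: "real^'s^'s \<Rightarrow> bool" where
  "irreducible_matrix P \<longleftrightarrow> (\<forall>i j. \<exists>n. matrix_power P n $ i $ j > 0)"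

definition aperiodic_matrix :: "real^'s^'s \<Rightarrow> bool" where
  "aperiodic_matrix P \<longleftrightarrow> (\<forall>i. Gcd {n. n \<ge> 1 \<and> matrix_power P n $ i $ i > 0} = 1)"

definition stationary_distribution :: "real^'s^'s \<Rightarrow> 's::finite pmf \<Rightarrow> bool" where
  "stationary_distribution P \<pi> \<longleftrightarrow> (\<chi> i. pmf \<pi> i) v* P = (\<chi> i. pmf \<pi> i)"

definition markov_chain ::
  "'w measure \<Rightarrow> (nat \<Rightarrow> 'w \<Rightarrow> 's::finite) \<Rightarrow> 's pmf \<Rightarrow> real^'s^'s \<Rightarrow> bool" where
  "markov_chain M Z \<mu> P \<longleftrightarrow>
     stochastic_matrix P \<and>
     (\<forall>n\<ge>1. Z n \<in> measurable M (count_space UNIV)) \<and>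
     (\<forall>s. \<P>(\<omega> in M. Z 1 \<omega> = s) = pmf \<mu> s) \<and>
     (\<forall>n\<ge>1. \<forall>z :: nat \<Rightarrow> 's. \<P>(\<omega> in M. \<forall>k\<in>{1..n}. Z k \<omega> = z k) > 0 \<longrightarrow>
        \<P>(\<omega> in M. Z (Suc n) \<omega> = z (Suc n) \<bar> \<forall>k\<in>{1..n}. Z k \<omega> = z k)
          = P $ z n $ z (Suc n))"

section \<open>Conditional independence and hidden Markov models\<close>

text \<open>The conditional probability of an event given a sub-sigma-algebra \<open>F\<close>, a random variable
  determined up to null sets.\<close>

definition cond_probability :: "'w measure \<Rightarrow> 'w measure \<Rightarrow> 'w set \<Rightarrow> 'w \<Rightarrow> real" where
  "cond_probability M F E = real_cond_exp M F (indicator E)"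

definition cond_indep_vars ::
  "'w measure \<Rightarrow> 'w measure \<Rightarrow> ('i \<Rightarrow> 'b measure) \<Rightarrow> ('i \<Rightarrow> 'w \<Rightarrow> 'b) \<Rightarrow> 'i set \<Rightarrow> bool" where
  "cond_indep_vars M F N W I \<longleftrightarrow>
     (\<forall>i\<in>I. W i \<in> measurable M (N i)) \<and>
     (\<forall>J\<subseteq>I. J \<noteq> {} \<longrightarrow> finite J \<longrightarrow> (\<forall>B\<in>(\<Pi> j\<in>J. sets (N j)).
        AE \<omega> in M. cond_probability M F (\<Inter>j\<in>J. W j -` B j \<inter> space M) \<omega>
                    = (\<Prod>j\<in>J. cond_probability M F (W j -` B j \<inter> space M) \<omega>)))"

definition sigma_of_process :: "'w measure \<Rightarrow> (nat \<Rightarrow> 'w \<Rightarrow> 's) \<Rightarrow> 'w measure" where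
  "sigma_of_process M Z = sigma (space M) {Z n -` B \<inter> space M | n B. n \<ge> 1}"

text \<open>\<open>Q s\<close> is the emission distribution of the state \<open>s\<close>.\<close>

definition hidden_markov_model ::
  "'w measure \<Rightarrow> (nat \<Rightarrow> 'w \<Rightarrow> 's::finite) \<Rightarrow> (nat \<Rightarrow> 'w \<Rightarrow> 'a::finite) \<Rightarrow> (nat \<Rightarrow> 'w \<Rightarrow> 'a) \<Rightarrow>
   's pmf \<Rightarrow> real^'s^'s \<Rightarrow> ('s \<Rightarrow> ('a \<times> 'a) pmf) \<Rightarrow> bool" where
  "hidden_markov_model M Z X Y \<mu> P Q \<longleftrightarrow>
     markov_chain M Z \<mu> P \<and>
     cond_indep_vars M (sigma_of_process M Z) (\<lambda>_. count_space UNIV) (\<lambda>n \<omega>. (X n \<omega>, Y n \<omega>)) {1..} \<and>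
     (\<forall>n\<ge>1. \<forall>B. AE \<omega> in M.
        cond_probability M (sigma_of_process M Z) {\<omega>' \<in> space M. (X n \<omega>', Y n \<omega>') \<in> B} \<omega>
          = measure_pmf.prob (Q (Z n \<omega>)) B)"

section \<open>Longest common subsequences\<close>

definition LC :: "(nat \<Rightarrow> 'w \<Rightarrow> 'a) \<Rightarrow> (nat \<Rightarrow> 'w \<Rightarrow> 'a) \<Rightarrow> nat \<Rightarrow> 'w \<Rightarrow> nat" where
  "LC X Y n \<omega> = Max {k. \<exists>i j :: nat \<Rightarrow> nat.
     strict_mono_on {1..k} i \<and> i ` {1..k} \<subseteq> {1..n} \<and>
     strict_mono_on {1..k} j \<and> j ` {1..k} \<subseteq> {1..n} \<and>
     (\<forall>s\<in>{1..k}. X (i s) \<omega> = Y (j s) \<omega>)}"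

text \<open>The set in \<^const>\<open>LC\<close> is finite and contains \<open>0\<close>, so \<^const>\<open>Max\<close> is a genuine maximum;
  likewise \<^const>\<open>sigma_of_process\<close> is a sub-sigma-algebra, as \<^const>\<open>real_cond_exp\<close> requires.\<close>

lemma LC_set_bounded:
  assumes "strict_mono_on {1..k} (i :: nat \<Rightarrow> nat)" "i ` {1..k} \<subseteq> {1..n}"
  shows "k \<le> n"
  using card_inj_on_le[OF strict_mono_on_imp_inj_on[OF assms(1)] assms(2)] by simp

lemma subalgebra_sigma_of_process:
  assumes "\<And>n. n \<ge> 1 \<Longrightarrow> Z n \<in> measurable M (count_space UNIV)"
  shows "subalgebra M (sigma_of_process M Z)"
  using assms unfolding subalgebra_def sigma_of_process_def
  by (auto simp: sets_measure_of_conv space_measure_of_conv intro!: sets.sigma_sets_subset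
        measurable_sets)

end

theory Submission
  imports Defs "HOL-Library.Sublist"
begin

text \<open>
  The mean of \<open>LC\<^sub>n\<close> depends on the model only through the initial law, the transition matrix and the
  emission laws: it is the average over the initial law of the means \<open>e s n\<close> for the chain started in
  the state \<open>s\<close> (\<open>expectation_letters\<close>). So the theorem is a statement about the growth of the finitely
  many sequences \<open>e s\<close>.

  Common subsequences of consecutive blocks concatenate, and by the Markov property the second block
  restarts from the state that the chain has reached. Hence the minimum \<open>m n\<close> of \<open>e s n\<close> over all \<open>s\<close>
  is superadditive (\<open>least_mean_lcs_superadditive\<close>). As \<open>0 \<le> m n \<le> n\<close>, Fekete's lemma gives a limit of
  \<open>m n / n\<close> in \<open>[0, 1]\<close> that is at least every single quotient.

  The starting state changes the mean only by a bounded amount (\<open>mean_lcs_spread_bounded\<close>). Shifting the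
  observation window by \<open>k\<close> steps raises \<open>LC\<^sub>n\<close> by at most \<open>k\<close>, and by irreducibility the
  chain moves from a worst starting state to any other one in boundedly many steps with a probability
  bounded away from \<open>0\<close>. If some starting state were much better than the worst one, the
  worst one would profit from this. So every initial law leads to the same limit as \<open>m\<close>.

  The limit is positive as soon as one value of \<open>m\<close> is positive. The hypothesis on the letter \<open>a\<close>
  provides a state that can emit \<open>a\<close> in the first component and a state that can emit it in the second.
  By irreducibility the chain visits the one and later the other with positive probability, whatever
  its starting state, and then a match occurs with positive probability (\<open>mean_lcs_pos\<close>).
\<close>

section \<open>Superadditive sequences\<close>

text \<open>Fekete's lemma: cutting \<open>n\<close> into \<open>n div N\<close> blocks of length \<open>N\<close> gives
  \<open>m n \<ge> (n div N) * m N\<close>, so \<open>m n / n\<close> is eventually almost as large as any single quotient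
  \<open>m N / N\<close> and the limit is the supremum. That the limit dominates every quotient is what yields
  a positive rate from one positive value.\<close>

lemma superadditive_quotient_converges:
  fixes m :: "nat \<Rightarrow> real"
  assumes super: "\<And>i j. m i + m j \<le> m (i + j)"
    and nonneg: "\<And>n. 0 \<le> m n" and bound: "\<And>n. m n \<le> real n"
  shows "\<exists>L\<le>1. (\<lambda>n. m n / real n) \<longlonglongrightarrow> L \<and> (\<forall>n\<ge>1. m n / real n \<le> L)"
proof -
  let ?q = "\<lambda>n. m n / real n"
  define L where "L = (SUP n\<in>{1..}. ?q n)"
  have q1: "?q n \<le> 1" for n
    using bound[of n] by (cases "n = 0") (auto simp: divide_simps)
  have bdd: "bdd_above (?q ` {1..})"
    by (rule bdd_aboveI[of _ 1]) (use q1 in auto)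
  have upper: "?q n \<le> L" if "n \<ge> 1" for n
    unfolding L_def using that by (intro cSUP_upper bdd) auto
  have "L \<le> 1"
    unfolding L_def by (rule cSUP_least) (use q1 in auto)
  have mult: "real q * m N \<le> m (q * N)" for q N
  proof (induction q)
    case 0
    then show ?case using nonneg[of 0] by simp
  next
    case (Suc q)
    then show ?case using super[of N "q * N"] by (simp add: algebra_simps)
  qed
  have lower: "?q N - real N / real n \<le> ?q n" if "N \<ge> 1" "n \<ge> 1" for N n
  proof -
    have n: "n = (n div N) * N + n mod N" by simp
    have "real (n div N) * m N \<le> m ((n div N) * N)" by (rule mult)
    also have "\<dots> \<le> m n"
      using super[of "(n div N) * N" "n mod N"] nonneg[of "n mod N"] n by simp
    finally have 1: "real (n div N) * m N \<le> m n" .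
    \<comment> \<open>The incomplete last block has fewer than \<open>N\<close> elements, hence costs at most \<open>m N \<le> N\<close>.\<close>
    have "n \<le> (n div N) * N + N"
      using n mod_less_divisor[of N n] that(1) by linarith
    then have "real n \<le> real (n div N) * real N + real N"
      by (metis of_nat_add of_nat_le_iff of_nat_mult)
    then have "real n * ?q N \<le> (real (n div N) * real N + real N) * ?q N"
      by (intro mult_right_mono) (use nonneg in auto)
    also have "\<dots> = real (n div N) * m N + m N"
      using that by (simp add: field_simps)
    also have "\<dots> \<le> m n + real N"
      using 1 bound[of N] by linarith
    finally have "?q N \<le> (m n + real N) / real n"
      using that by (simp add: pos_le_divide_eq mult.commute)
    then show ?thesis
      by (simp add: add_divide_distrib)
  qed
  have "?q \<longlonglongrightarrow> L"
  proof (rule LIMSEQ_I)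
    fix e :: real assume "0 < e"
    then have "L - e / 2 < (SUP n\<in>{1..}. ?q n)" by (simp add: L_def)
    then have "\<exists>N\<in>{1..}. L - e / 2 < ?q N"
      by (subst (asm) less_cSUP_iff[OF _ bdd]) auto
    then obtain N where N: "N \<ge> 1" "L - e / 2 < ?q N" by auto
    have "\<forall>\<^sub>F n in sequentially. real N / real n < e / 2"
      using \<open>0 < e\<close> lim_const_over_n[of "real N"] by (intro order_tendstoD(2)) auto
    then obtain n0 where n0: "\<And>n. n \<ge> n0 \<Longrightarrow> real N / real n < e / 2"
      by (auto simp: eventually_sequentially)
    show "\<exists>no. \<forall>n\<ge>no. norm (?q n - L) < e"
    proof (intro exI allI impI)
      fix n assume "max 1 n0 \<le> n"
      then show "norm (?q n - L) < e"
        using lower[OF N(1), of n] upper[of n] n0[of n] N(2) by auto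
    qed
  qed
  then show ?thesis using upper \<open>L \<le> 1\<close> by blast
qed

section \<open>Longest common subsequences of a word of pairs\<close>

text \<open>A word of pairs stands for the two words of its first and its second components. Expressing
  common subsequences by \<^const>\<open>subseq\<close> rather than by index functions makes the behaviour under
  concatenation immediate.\<close>

definition lcs :: "('a \<times> 'a) list \<Rightarrow> nat" where
  "lcs ws = Max {length zs | zs. subseq zs (map fst ws) \<and> subseq zs (map snd ws)}"

lemma finite_common_subseqs:
  "finite {length zs | zs. subseq zs (map fst ws) \<and> subseq zs (map snd ws)}"
  by (rule finite_subset[of _ "{..length ws}"]) (auto dest: list_emb_length)

lemma le_lcsI:
  "subseq zs (map fst ws) \<Longrightarrow> subseq zs (map snd ws) \<Longrightarrow> length zs \<le> lcs ws"
  unfolding lcs_def by (intro Max_ge finite_common_subseqs) auto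

lemma lcs_witness:
  obtains zs where "subseq zs (map fst ws)" "subseq zs (map snd ws)" "length zs = lcs ws"
proof -
  have "length [] \<in> {length zs | zs. subseq zs (map fst ws) \<and> subseq zs (map snd ws)}"
    by (intro CollectI exI[of _ "[]"]) auto
  then have "lcs ws \<in> {length zs | zs. subseq zs (map fst ws) \<and> subseq zs (map snd ws)}"
    unfolding lcs_def by (intro Max_in finite_common_subseqs) blast
  then show ?thesis using that by auto
qed

lemma lcs_le_length: "lcs ws \<le> length ws"
  by (rule lcs_witness[of ws]) (metis list_emb_length length_map)

lemma lcs_append_superadditive: "lcs us + lcs vs \<le> lcs (us @ vs)"
proof -
  obtain xs where xs: "subseq xs (map fst us)" "subseq xs (map snd us)" "length xs = lcs us"
    by (rule lcs_witness)
  obtain ys where ys: "subseq ys (map fst vs)" "subseq ys (map snd vs)" "length ys = lcs vs"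
    by (rule lcs_witness)
  show ?thesis
    using le_lcsI[of "xs @ ys" "us @ vs"] xs ys by (simp add: list_emb_append_mono)
qed

lemma subseq_butlast_snoc:
  assumes "subseq zs (xs @ [x])"
  shows "subseq (butlast zs) xs"
proof -
  obtain us vs where zs: "zs = us @ vs" and us: "subseq us xs" and vs: "subseq vs [x]"
    using assms by (rule subseq_appendE)
  from vs have "length vs \<le> 1"
    using list_emb_length by fastforce
  then have "vs = [] \<or> (\<exists>v. vs = [v])"
    by (cases vs) auto
  then show ?thesis
  proof
    assume "vs = []"
    moreover have "subseq (butlast us) us"
      by (simp add: prefix_imp_subseq prefixeq_butlast)
    ultimately show ?thesis
      using us zs subseq_order.order_trans by auto
  qed (use us zs in \<open>auto simp: butlast_append\<close>)
qed

text \<open>A matching of \<open>zs\<close> uses the new last pair at most for the last letter of \<open>zs\<close>, on either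
  side, so dropping that letter leaves a common subsequence of the shorter word.\<close>

lemma lcs_snoc: "lcs (ws @ [p]) \<le> lcs ws + 1"
proof -
  obtain zs where "subseq zs (map fst (ws @ [p]))" "subseq zs (map snd (ws @ [p]))"
    and len: "length zs = lcs (ws @ [p])"
    by (rule lcs_witness)
  then have "length (butlast zs) \<le> lcs ws"
    by (intro le_lcsI) (auto intro: subseq_butlast_snoc)
  with len show ?thesis by simp
qed

lemma lcs_append_le: "lcs (us @ vs) \<le> lcs us + length vs"
proof (induction vs rule: rev_induct)
  case (snoc p vs)
  then show ?case using lcs_snoc[of "us @ vs" p] by simp
qed simp

lemma lcs_pos:
  assumes "(a, b) \<in> set ws" "(c, a) \<in> set ws"
  shows "1 \<le> lcs ws"
proof -
  have "subseq [a] (map fst ws)" "subseq [a] (map snd ws)"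
    using assms by (force simp: subseq_singleton_left)+
  from le_lcsI[OF this] show ?thesis by simp
qed

text \<open>Translates between the two presentations of a subsequence: as a list, and as an increasing
  choice of positions, which start at \<open>1\<close> and therefore need the shift \<open>s - 1\<close>.\<close>

lemma subseq_map_upt_iff:
  "subseq zs (map x [1..<Suc n]) \<longleftrightarrow>
     (\<exists>i. strict_mono_on {1..length zs} i \<and> i ` {1..length zs} \<subseteq> {1..n} \<and>
          (\<forall>s\<in>{1..length zs}. zs ! (s - 1) = x (i s)))"
  (is "?lhs \<longleftrightarrow> ?rhs")
proof
  assume ?lhs
  then obtain N where N: "zs = map x (nths [1..<Suc n] N)"
    by (auto simp: subseq_conv_nths nths_map simp del: upt_Suc)
  define idx where "idx = nths [1..<Suc n] N"
  have sorted: "sorted_wrt (<) idx"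
    unfolding idx_def by (simp add: strict_sorted_iff sorted_nths distinct_nthsI del: upt_Suc)
  have len: "length zs = length idx" and set: "set idx \<subseteq> {1..n}"
    using set_nths_subset[of "[1..<Suc n]" N] unfolding N idx_def by auto
  have zs: "zs = map x idx" using N idx_def by simp
  let ?i = "\<lambda>s. idx ! (s - 1)"
  have "strict_mono_on {1..length zs} ?i"
    by (rule strict_mono_onI) (auto simp: len intro!: sorted_wrt_nth_less[OF sorted])
  moreover have "?i s \<in> {1..n}" if "s \<in> {1..length zs}" for s
    using that set nth_mem[of "s - 1" "idx"] unfolding len by fastforce
  moreover have "zs ! (s - 1) = x (?i s)" if "s \<in> {1..length zs}" for s
    using that by (auto simp: zs)
  ultimately show ?rhs by (intro exI[of _ ?i]) auto
next
  assume ?rhs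
  then obtain i where i: "strict_mono_on {1..length zs} i" "i ` {1..length zs} \<subseteq> {1..n}"
    "\<And>s. s \<in> {1..length zs} \<Longrightarrow> zs ! (s - 1) = x (i s)" by blast
  have "zs = map x (map i [1..<Suc (length zs)])"
    by (rule nth_equalityI) (use i(3)[of "Suc _"] in \<open>auto simp del: upt_Suc\<close>)
  moreover have "subseq (map i [1..<Suc (length zs)]) [1..<Suc n]"
  proof (rule sorted_subset_imp_subseq)
    show "sorted_wrt (<) (map i [1..<Suc (length zs)])"
      by (auto simp: sorted_wrt_iff_nth_less simp del: upt_Suc intro!: strict_mono_onD[OF i(1)])
    show "set (map i [1..<Suc (length zs)]) \<subseteq> set [1..<Suc n]"
      using i(2) by (simp add: atLeastLessThanSuc_atLeastAtMost del: upt_Suc)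
  qed (simp del: upt_Suc)
  ultimately show ?lhs by (metis subseq_map)
qed

lemma LC_eq_lcs: "LC X Y n \<omega> = lcs (map (\<lambda>i. (X i \<omega>, Y i \<omega>)) [1..<Suc n])"
proof -
  let ?x = "\<lambda>i. X i \<omega>" and ?y = "\<lambda>i. Y i \<omega>"
  have "(\<exists>i j. strict_mono_on {1..k} i \<and> i ` {1..k} \<subseteq> {1..n} \<and>
          strict_mono_on {1..k} j \<and> j ` {1..k} \<subseteq> {1..n} \<and>
          (\<forall>s\<in>{1..k}. ?x (i s) = ?y (j s)))
     \<longleftrightarrow> (\<exists>zs. k = length zs \<and> subseq zs (map ?x [1..<Suc n]) \<and> subseq zs (map ?y [1..<Suc n]))"
    (is "?L k \<longleftrightarrow> ?R k") for k
  proof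
    assume "?L k"
    then obtain i j where i: "strict_mono_on {1..k} i" "i ` {1..k} \<subseteq> {1..n}"
      and j: "strict_mono_on {1..k} j" "j ` {1..k} \<subseteq> {1..n}"
      and eq: "\<And>s. s \<in> {1..k} \<Longrightarrow> ?x (i s) = ?y (j s)" by blast
    define zs where "zs = map (\<lambda>s. ?x (i s)) [1..<Suc k]"
    have k: "length zs = k" by (simp add: zs_def del: upt_Suc)
    have nth: "zs ! (s - 1) = ?x (i s)" if "s \<in> {1..k}" for s
      using that by (auto simp: zs_def simp del: upt_Suc)
    have "subseq zs (map ?x [1..<Suc n])" "subseq zs (map ?y [1..<Suc n])"
      unfolding subseq_map_upt_iff k using i j nth eq by metis+
    with k show "?R k" by blast
  next
    assume "?R k"
    then show "?L k" unfolding subseq_map_upt_iff by metis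
  qed
  then show ?thesis
    unfolding LC_def lcs_def by (simp add: comp_def del: upt_Suc)
qed

section \<open>Expectations over emitted words\<close>

text \<open>The expectation of \<open>f\<close> applied to the first \<open>n\<close> letters emitted by the chain started in
  \<open>s\<close>, where the starting state emits the first letter. It is defined by conditioning on that letter
  and on the next state, so that it depends on \<open>P\<close> and \<open>Q\<close> only, is defined for every starting state,
  and turns the Markov property into an induction on \<open>n\<close>.\<close>

primrec word_expectation ::
  "real^'s^'s \<Rightarrow> ('s \<Rightarrow> 'b::finite pmf) \<Rightarrow> nat \<Rightarrow> 's::finite \<Rightarrow> ('b list \<Rightarrow> real) \<Rightarrow> real" where
  "word_expectation P Q 0 s f = f []"
| "word_expectation P Q (Suc n) s f =
     (\<Sum>b\<in>UNIV. pmf (Q s) b *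
       (\<Sum>t\<in>UNIV. P $ s $ t * word_expectation P Q n t (\<lambda>ws. f (b # ws))))"

locale emitting_chain =
  fixes P :: "real^'s^'s::finite" and Q :: "'s \<Rightarrow> 'b::finite pmf"
  assumes stochastic: "stochastic_matrix P"
begin

abbreviation E :: "nat \<Rightarrow> 's \<Rightarrow> ('b list \<Rightarrow> real) \<Rightarrow> real" where
  "E \<equiv> word_expectation P Q"

lemma P_nonneg: "0 \<le> P $ s $ t" and P_row_sum: "(\<Sum>t\<in>UNIV. P $ s $ t) = 1"
  using stochastic by (auto simp: stochastic_matrix_def)

lemma Q_sum: "(\<Sum>b\<in>UNIV. pmf (Q s) b) = 1"
  by (rule sum_pmf_eq_1) auto

lemma E_mono:
  "(\<And>ws. length ws = n \<Longrightarrow> f ws \<le> g ws) \<Longrightarrow> E n s f \<le> E n s g"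
proof (induction n arbitrary: s f g)
  case (Suc n)
  then show ?case
    by (auto intro!: sum_mono mult_left_mono P_nonneg)
qed simp

lemma E_add: "E n s (\<lambda>ws. f ws + g ws) = E n s f + E n s g"
  by (induction n arbitrary: s f g) (simp_all add: sum.distrib distrib_left)

lemma E_const: "E n s (\<lambda>_. c) = c"
  by (induction n arbitrary: s) (simp_all flip: sum_distrib_right add: P_row_sum Q_sum)

lemma E_take: "E (n + m) s (\<lambda>ws. f (take n ws)) = E n s f"
proof (induction n arbitrary: s f)
  case 0
  then show ?case by (simp add: E_const)
next
  case (Suc n)
  show ?case
    using Suc.IH[of _ "\<lambda>ws. f (_ # ws)"] by simp
qed

lemma matrix_power_Suc:
  "matrix_power P (Suc n) $ s $ t = (\<Sum>u\<in>UNIV. P $ s $ u * matrix_power P n $ u $ t)"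
  by (simp add: matrix_power_def matrix_matrix_mult_def)

text \<open>The Markov property: after \<open>n\<close> letters the word goes on as if restarted from the state
  reached, whose law is row \<open>s\<close> of the \<open>n\<close>-th matrix power.\<close>

lemma E_drop:
  "E (n + m) s (\<lambda>ws. f (drop n ws)) = (\<Sum>t\<in>UNIV. matrix_power P n $ s $ t * E m t f)"
proof (induction n arbitrary: s)
  case 0
  have "(\<Sum>t\<in>UNIV. matrix_power P 0 $ s $ t * E m t f) = (\<Sum>t\<in>UNIV. if s = t then E m t f else 0)"
    by (intro sum.cong) (auto simp: matrix_power_def mat_def)
  then show ?case by simp
next
  case (Suc n)
  have "E (Suc n + m) s (\<lambda>ws. f (drop (Suc n) ws))
      = (\<Sum>u\<in>UNIV. P $ s $ u * (\<Sum>t\<in>UNIV. matrix_power P n $ u $ t * E m t f))"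
    by (simp add: Suc.IH Q_sum flip: sum_distrib_right)
  also have "\<dots> = (\<Sum>t\<in>UNIV. (\<Sum>u\<in>UNIV. P $ s $ u * matrix_power P n $ u $ t) * E m t f)"
    by (simp add: sum_distrib_left sum_distrib_right mult.assoc) (rule sum.swap)
  finally show ?case by (simp only: matrix_power_Suc)
qed

lemma matrix_power_nonneg: "0 \<le> matrix_power P n $ s $ t"
proof (induction n arbitrary: s)
  case 0
  then show ?case by (simp add: matrix_power_def mat_def)
next
  case (Suc n)
  then show ?case
    unfolding matrix_power_Suc by (intro sum_nonneg mult_nonneg_nonneg P_nonneg)
qed

text \<open>The Markov property for the constant function \<open>1\<close> on the empty remainder.\<close>

lemma matrix_power_row_sum: "(\<Sum>t\<in>UNIV. matrix_power P n $ s $ t) = 1"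
  using E_drop[of n 0 s "\<lambda>_. 1"] by (simp add: E_const)

lemma matrix_power_weight_le:
  assumes "\<And>u. 0 \<le> h u"
  shows "matrix_power P n $ s $ t * h t \<le> (\<Sum>u\<in>UNIV. matrix_power P n $ s $ u * h u)"
  using assms by (intro member_le_sum) (auto intro: matrix_power_nonneg mult_nonneg_nonneg)

end

section \<open>Growth rate of the mean longest common subsequence\<close>

locale pair_emitting_chain = emitting_chain P Q
  for P :: "real^'s^'s::finite" and Q :: "'s \<Rightarrow> ('a::finite \<times> 'a) pmf" +
  assumes irreducible: "irreducible_matrix P"
begin

definition mean_lcs :: "'s \<Rightarrow> nat \<Rightarrow> real" where
  "mean_lcs s n = E n s (\<lambda>ws. real (lcs ws))"

lemma mean_lcs_nonneg: "0 \<le> mean_lcs s n"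
  using E_mono[of n "\<lambda>_. 0" "\<lambda>ws. real (lcs ws)" s] by (simp add: mean_lcs_def E_const)

lemma mean_lcs_le: "mean_lcs s n \<le> real n"
  using E_mono[of n "\<lambda>ws. real (lcs ws)" "\<lambda>_. real n" s] lcs_le_length
  by (force simp: mean_lcs_def E_const)

text \<open>Match inside the first \<open>n\<close> letters and inside the last \<open>m\<close> letters separately.\<close>

lemma mean_lcs_superadditive:
  "mean_lcs s n + (\<Sum>t\<in>UNIV. matrix_power P n $ s $ t * mean_lcs t m) \<le> mean_lcs s (n + m)"
proof -
  have "mean_lcs s n + (\<Sum>t\<in>UNIV. matrix_power P n $ s $ t * mean_lcs t m)
      = E (n + m) s (\<lambda>ws. real (lcs (take n ws)) + real (lcs (drop n ws)))"
    unfolding mean_lcs_def E_add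
    using E_take[of n m s "\<lambda>ws. real (lcs ws)"] E_drop[of n m s "\<lambda>ws. real (lcs ws)"] by simp
  also have "\<dots> \<le> mean_lcs s (n + m)"
    unfolding mean_lcs_def
  proof (rule E_mono)
    fix ws :: "('a \<times> 'a) list"
    show "real (lcs (take n ws)) + real (lcs (drop n ws)) \<le> real (lcs ws)"
      using lcs_append_superadditive[of "take n ws" "drop n ws"] by simp
  qed
  finally show ?thesis .
qed

text \<open>Discarding the first \<open>k\<close> letters and reading \<open>k\<close> further ones gains at most \<open>k\<close>: the shifted
  block lies in the block of length \<open>n + k\<close>, and each of its last \<open>k\<close> letters contributes at most
  one.\<close>

lemma mean_lcs_shift:
  "(\<Sum>t\<in>UNIV. matrix_power P k $ s $ t * mean_lcs t n) \<le> mean_lcs s n + real k"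
proof -
  have "(\<Sum>t\<in>UNIV. matrix_power P k $ s $ t * mean_lcs t n) \<le> mean_lcs s (k + n)"
    using mean_lcs_superadditive[of s k n] mean_lcs_nonneg[of s k] by linarith
  also have "\<dots> \<le> E (n + k) s (\<lambda>ws. real (lcs (take n ws)) + real k)"
    unfolding mean_lcs_def add.commute[of k n]
  proof (rule E_mono)
    fix ws :: "('a \<times> 'a) list" assume "length ws = n + k"
    then show "real (lcs ws) \<le> real (lcs (take n ws)) + real k"
      using lcs_append_le[of "take n ws" "drop n ws"] by simp
  qed
  also have "\<dots> = mean_lcs s n + real k"
    unfolding mean_lcs_def E_add E_const using E_take[of n k s "\<lambda>ws. real (lcs ws)"] by simp
  finally show ?thesis .
qed

text \<open>For a fixed starting state the mean is superadditive only up to the law of the state after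
  \<open>n\<close> steps. The worst starting state removes this dependence, and then superadditivity holds exactly.\<close>

definition least_mean_lcs :: "nat \<Rightarrow> real" where
  "least_mean_lcs n = Min (range (\<lambda>s. mean_lcs s n))"

lemma least_mean_lcs_le: "least_mean_lcs n \<le> mean_lcs s n"
  by (simp add: least_mean_lcs_def)

lemma least_mean_lcs_attained: "\<exists>s. least_mean_lcs n = mean_lcs s n"
proof -
  have "least_mean_lcs n \<in> range (\<lambda>s. mean_lcs s n)"
    unfolding least_mean_lcs_def by (rule Min_in) auto
  then show ?thesis by auto
qed

lemma least_mean_lcs_le_average:
  "least_mean_lcs m \<le> (\<Sum>t\<in>UNIV. matrix_power P n $ s $ t * mean_lcs t m)"
proof -
  have "least_mean_lcs m = (\<Sum>t\<in>UNIV. matrix_power P n $ s $ t * least_mean_lcs m)"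
    by (simp add: matrix_power_row_sum flip: sum_distrib_right)
  also have "\<dots> \<le> (\<Sum>t\<in>UNIV. matrix_power P n $ s $ t * mean_lcs t m)"
    by (intro sum_mono mult_left_mono least_mean_lcs_le matrix_power_nonneg)
  finally show ?thesis .
qed

lemma least_mean_lcs_superadditive: "least_mean_lcs n + least_mean_lcs m \<le> least_mean_lcs (n + m)"
proof -
  obtain s where s: "least_mean_lcs (n + m) = mean_lcs s (n + m)"
    using least_mean_lcs_attained by blast
  show ?thesis
    using s mean_lcs_superadditive[of s n m] least_mean_lcs_le[of n s]
      least_mean_lcs_le_average[of m n s] by linarith
qed

text \<open>Let \<open>s\<close> be a worst and \<open>t\<close> any starting state, and let \<open>t\<close> be reached from \<open>s\<close> in \<open>k\<close> steps
  with probability \<open>p > 0\<close>. The mean from the state after \<open>k\<close> steps, averaged over that state, exceeds the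
  least mean by at most \<open>k\<close>. This average gives weight \<open>p\<close> to \<open>t\<close>, and no state lies below the least
  mean. So the mean from \<open>t\<close> exceeds it by at most \<open>k / p\<close>, and there are finitely many pairs
  \<open>(s, t)\<close>.\<close>

lemma mean_lcs_spread_bounded: "\<exists>C. \<forall>n s. mean_lcs s n \<le> least_mean_lcs n + C"
proof -
  have "\<exists>C. \<forall>n. mean_lcs s n = least_mean_lcs n \<longrightarrow> mean_lcs t n \<le> least_mean_lcs n + C" for s t
  proof -
    obtain k where k: "matrix_power P k $ s $ t > 0" (is "?p > 0")
      using irreducible by (auto simp: irreducible_matrix_def)
    have "mean_lcs t n \<le> least_mean_lcs n + real k / ?p" if s: "mean_lcs s n = least_mean_lcs n" for n
    proof -
      have "?p * (mean_lcs t n - least_mean_lcs n)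
          \<le> (\<Sum>u\<in>UNIV. matrix_power P k $ s $ u * (mean_lcs u n - least_mean_lcs n))"
        by (rule matrix_power_weight_le) (simp add: least_mean_lcs_le)
      also have "\<dots> = (\<Sum>u\<in>UNIV. matrix_power P k $ s $ u * mean_lcs u n) - least_mean_lcs n"
        by (simp add: right_diff_distrib sum_subtractf matrix_power_row_sum flip: sum_distrib_right)
      also have "\<dots> \<le> real k"
        using mean_lcs_shift[of k s n] s by simp
      finally show ?thesis using k by (simp add: field_simps)
    qed
    then show ?thesis by blast
  qed
  then obtain C where C: "\<And>s t n. mean_lcs s n = least_mean_lcs n \<Longrightarrow>
      mean_lcs t n \<le> least_mean_lcs n + C s t" by metis
  have "mean_lcs t n \<le> least_mean_lcs n + Max (range (\<lambda>(s, t). C s t))" for t n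
  proof -
    obtain s where s: "least_mean_lcs n = mean_lcs s n" using least_mean_lcs_attained by blast
    have "C s t \<le> Max (range (\<lambda>(s, t). C s t))"
      by (intro Max_ge) (auto intro: rev_image_eqI[of "(s, t)"])
    then show ?thesis using C[OF s[symmetric], of t] by linarith
  qed
  then show ?thesis by blast
qed

text \<open>From \<open>s\<close> the chain can reach \<open>s0\<close>, leave it by a first step to some \<open>u\<close>, and then reach
  \<open>t0\<close>. Along this route \<open>a\<close> can be emitted first in \<open>s0\<close> and, strictly later, in \<open>t0\<close>. The
  intermediate state \<open>u\<close> separates the two times even if \<open>s0 = t0\<close>, so the two emissions are
  conditionally independent.\<close>

lemma mean_lcs_pos:
  assumes a: "pmf (Q s0) (a, b) > 0" "pmf (Q t0) (c, a) > 0"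
  shows "\<exists>n. mean_lcs s n > 0"
proof -
  have "\<exists>u. P $ s0 $ u > 0"
  proof (rule ccontr)
    assume "\<nexists>u. P $ s0 $ u > 0"
    then have "\<And>u. P $ s0 $ u = 0" using P_nonneg by (metis less_eq_real_def)
    then show False using P_row_sum[of s0] by simp
  qed
  then obtain u where u: "P $ s0 $ u > 0" ..
  obtain k where k: "matrix_power P k $ u $ t0 > 0"
    using irreducible by (auto simp: irreducible_matrix_def)
  obtain l where l: "matrix_power P l $ s $ s0 > 0"
    using irreducible by (auto simp: irreducible_matrix_def)
  \<comment> \<open>Whether the word after the first letter contains \<open>(c, a)\<close>; then a match of the
    letter \<open>a\<close> arises once \<open>(a, b)\<close> has been put in front.\<close>
  define g :: "('a \<times> 'a) list \<Rightarrow> real" where "g ws = (if (c, a) \<in> set ws then 1 else 0)" for ws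
  have g_nonneg: "0 \<le> E n t (\<lambda>ws. f ws)" if "\<And>ws. 0 \<le> f ws" for n t f
    using E_mono[of n "\<lambda>_. 0" f t] that by (simp add: E_const)
  have "0 < matrix_power P k $ u $ t0 * E 1 t0 g"
  proof -
    have "E 1 t0 g = (\<Sum>p\<in>UNIV. pmf (Q t0) p * g [p])"
      by (simp add: P_row_sum flip: sum_distrib_right)
    also have "\<dots> = (\<Sum>p\<in>UNIV. if (c, a) = p then pmf (Q t0) p else 0)"
      by (intro sum.cong) (auto simp: g_def)
    finally have "E 1 t0 g = pmf (Q t0) (c, a)" by simp
    then show ?thesis using k a(2) by simp
  qed
  also have "\<dots> \<le> (\<Sum>t\<in>UNIV. matrix_power P k $ u $ t * E 1 t g)"
    by (rule matrix_power_weight_le, rule g_nonneg) (simp add: g_def)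
  also have "\<dots> = E (k + 1) u (\<lambda>ws. g (drop k ws))"
    by (simp only: E_drop)
  also have "\<dots> \<le> E (k + 1) u (\<lambda>ws. real (lcs ((a, b) # ws)))"
  proof (rule E_mono)
    fix ws show "g (drop k ws) \<le> real (lcs ((a, b) # ws))"
      using lcs_pos[of a b "(a, b) # ws" c] in_set_dropD[of "(c, a)" k ws] by (auto simp: g_def)
  qed
  finally have pos: "0 < E (k + 1) u (\<lambda>ws. real (lcs ((a, b) # ws)))" .
  have "0 < pmf (Q s0) (a, b) * (P $ s0 $ u * E (k + 1) u (\<lambda>ws. real (lcs ((a, b) # ws))))"
    using pos u a(1) by simp
  also have "\<dots> \<le> pmf (Q s0) (a, b) *
      (\<Sum>t\<in>UNIV. P $ s0 $ t * E (k + 1) t (\<lambda>ws. real (lcs ((a, b) # ws))))"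
    by (intro mult_left_mono member_le_sum) (auto intro!: mult_nonneg_nonneg P_nonneg g_nonneg simp del: word_expectation.simps)
  also have "\<dots> \<le> mean_lcs s0 (Suc (k + 1))"
    unfolding mean_lcs_def word_expectation.simps(2)[of _ _ "k + 1"]
    by (intro member_le_sum[where f = "\<lambda>p. pmf (Q s0) p *
        (\<Sum>t\<in>UNIV. P $ s0 $ t * E (k + 1) t (\<lambda>ws. real (lcs (p # ws))))"])
      (auto intro!: mult_nonneg_nonneg sum_nonneg P_nonneg g_nonneg simp del: word_expectation.simps)
  finally have "0 < matrix_power P l $ s $ s0 * mean_lcs s0 (Suc (k + 1))"
    using l by simp
  also have "\<dots> \<le> (\<Sum>t\<in>UNIV. matrix_power P l $ s $ t * mean_lcs t (Suc (k + 1)))"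
    by (rule matrix_power_weight_le) (rule mean_lcs_nonneg)
  also have "\<dots> \<le> mean_lcs s (l + Suc (k + 1))"
    using mean_lcs_superadditive[of s l "Suc (k + 1)"] mean_lcs_nonneg[of s l] by linarith
  finally show ?thesis by blast
qed

lemma mean_lcs_mono: "n \<le> m \<Longrightarrow> mean_lcs s n \<le> mean_lcs s m"
proof -
  assume "n \<le> m"
  then obtain k where "m = n + k" using le_Suc_ex by blast
  moreover have "0 \<le> (\<Sum>t\<in>UNIV. matrix_power P n $ s $ t * mean_lcs t k)"
    by (intro sum_nonneg mult_nonneg_nonneg matrix_power_nonneg mean_lcs_nonneg)
  ultimately show ?thesis using mean_lcs_superadditive[of s n k] by simp
qed

lemma least_mean_lcs_pos:
  assumes "pmf (Q s0) (a, b) > 0" "pmf (Q t0) (c, a) > 0"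
  shows "\<exists>n\<ge>1. least_mean_lcs n > 0"
proof -
  obtain N where N: "\<And>s. mean_lcs s (N s) > 0"
    using mean_lcs_pos[OF assms] by metis
  define n where "n = Suc (Max (range N))"
  obtain s where s: "least_mean_lcs n = mean_lcs s n" using least_mean_lcs_attained by blast
  have "N s \<le> Max (range N)" by simp
  then have "N s \<le> n" unfolding n_def by (rule le_SucI)
  then have "0 < mean_lcs s n" using N[of s] mean_lcs_mono[of "N s" n s] by linarith
  then show ?thesis using s by (intro exI[of _ n]) (auto simp: n_def)
qed

text \<open>For every initial law the mean lies between the least mean and the least mean plus a
  constant, so all of them grow at the rate of the superadditive least mean.\<close>

lemma mean_lcs_rate:
  assumes "pmf (Q s0) (a, b) > 0" "pmf (Q t0) (c, a) > 0"
  shows "\<exists>\<gamma>. 0 < \<gamma> \<and> \<gamma> \<le> 1 \<and>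
    (\<forall>\<mu> :: 's pmf. (\<lambda>n. (\<Sum>s\<in>UNIV. pmf \<mu> s * mean_lcs s n) / real n) \<longlonglongrightarrow> \<gamma>)"
proof -
  have nonneg: "0 \<le> least_mean_lcs n" and bound: "least_mean_lcs n \<le> real n" for n
    using least_mean_lcs_attained[of n] mean_lcs_nonneg mean_lcs_le by metis+
  obtain \<gamma> where \<gamma>: "\<gamma> \<le> 1" "(\<lambda>n. least_mean_lcs n / real n) \<longlonglongrightarrow> \<gamma>"
      "\<And>n. n \<ge> 1 \<Longrightarrow> least_mean_lcs n / real n \<le> \<gamma>"
    using superadditive_quotient_converges[OF least_mean_lcs_superadditive nonneg bound] by blast
  obtain N where N: "N \<ge> 1" "least_mean_lcs N > 0"
    using least_mean_lcs_pos[OF assms] by blast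
  then have "0 < least_mean_lcs N / real N" by simp
  also have "\<dots> \<le> \<gamma>" using \<gamma>(3)[OF N(1)] .
  finally have "0 < \<gamma>" .
  obtain C where C: "\<And>n s. mean_lcs s n \<le> least_mean_lcs n + C"
    using mean_lcs_spread_bounded by blast
  have "(\<lambda>n. (\<Sum>s\<in>UNIV. pmf \<mu> s * mean_lcs s n) / real n) \<longlonglongrightarrow> \<gamma>" for \<mu> :: "'s pmf"
  proof (rule tendsto_sandwich[OF _ _ \<gamma>(2)])
    have total: "(\<Sum>s\<in>UNIV. pmf \<mu> s) = 1" by (rule sum_pmf_eq_1) auto
    have "(\<Sum>s\<in>UNIV. pmf \<mu> s * least_mean_lcs n) \<le> (\<Sum>s\<in>UNIV. pmf \<mu> s * mean_lcs s n)" for n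
      by (intro sum_mono mult_left_mono least_mean_lcs_le) auto
    then show "\<forall>\<^sub>F n in sequentially.
        least_mean_lcs n / real n \<le> (\<Sum>s\<in>UNIV. pmf \<mu> s * mean_lcs s n) / real n"
      by (intro always_eventually allI divide_right_mono)
         (simp_all add: total flip: sum_distrib_right)
    have "(\<Sum>s\<in>UNIV. pmf \<mu> s * mean_lcs s n) \<le> (\<Sum>s\<in>UNIV. pmf \<mu> s * (least_mean_lcs n + C))" for n
      by (intro sum_mono mult_left_mono C) auto
    then show "\<forall>\<^sub>F n in sequentially.
        (\<Sum>s\<in>UNIV. pmf \<mu> s * mean_lcs s n) / real n \<le> (least_mean_lcs n + C) / real n"
      by (intro always_eventually allI divide_right_mono)
         (simp_all add: total flip: sum_distrib_right)
    show "(\<lambda>n. (least_mean_lcs n + C) / real n) \<longlonglongrightarrow> \<gamma>"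
      using tendsto_add[OF \<gamma>(2) lim_const_over_n[of C]] by (simp add: add_divide_distrib)
  qed
  then show ?thesis using \<open>0 < \<gamma>\<close> \<gamma>(1) by blast
qed

end

section \<open>The law of the observed word\<close>

locale hidden_markov = prob_space M
  for M :: "'w measure" +
  fixes Z :: "nat \<Rightarrow> 'w \<Rightarrow> 's::finite"
    and X Y :: "nat \<Rightarrow> 'w \<Rightarrow> 'a::finite"
    and \<mu> :: "'s pmf" and P :: "real^'s^'s" and Q :: "'s \<Rightarrow> ('a \<times> 'a) pmf"
  assumes hmm: "hidden_markov_model M Z X Y \<mu> P Q"
begin

definition W :: "nat \<Rightarrow> 'w \<Rightarrow> 'a \<times> 'a" where
  "W n \<omega> = (X n \<omega>, Y n \<omega>)"

abbreviation F :: "'w measure" where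
  "F \<equiv> sigma_of_process M Z"

lemma chain: "markov_chain M Z \<mu> P"
  using hmm by (simp add: hidden_markov_model_def)

lemma Z_measurable: "n \<ge> 1 \<Longrightarrow> Z n \<in> measurable M (count_space UNIV)"
  using chain by (simp add: markov_chain_def)

lemma W_measurable: "n \<ge> 1 \<Longrightarrow> W n \<in> measurable M (count_space UNIV)"
  using hmm by (simp add: hidden_markov_model_def cond_indep_vars_def W_def[abs_def])

sublocale emitting_chain P Q
  using chain by unfold_locales (simp add: markov_chain_def)

sublocale latent: finite_measure_subalgebra M F
  by unfold_locales (rule subalgebra_sigma_of_process[OF Z_measurable])

lemma Z_measurable_F: "n \<ge> 1 \<Longrightarrow> Z n \<in> measurable F (count_space UNIV)"
  unfolding sigma_of_process_def
  by (rule measurableI) (auto simp: sets_measure_of_conv space_measure_of_conv)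

lemma space_F: "space F = space M"
  by (simp add: sigma_of_process_def space_measure_of_conv)

definition trajectory :: "nat \<Rightarrow> (nat \<Rightarrow> 's) \<Rightarrow> 'w set" where
  "trajectory k z = {\<omega> \<in> space M. \<forall>i\<in>{1..k}. Z i \<omega> = z i}"

lemma trajectory_in_F: "trajectory k z \<in> sets F"
proof -
  have "{\<omega> \<in> space F. \<forall>i\<in>{1..k}. Z i \<omega> = z i} \<in> sets F"
  proof (rule sets.sets_Collect_finite_All)
    fix i assume "i \<in> {1..k}"
    then have "Z i -` {z i} \<inter> space F \<in> sets F"
      by (intro measurable_sets[OF Z_measurable_F]) auto
    also have "Z i -` {z i} \<inter> space F = {\<omega> \<in> space F. Z i \<omega> = z i}" by auto
    finally show "{\<omega> \<in> space F. Z i \<omega> = z i} \<in> sets F" .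
  qed auto
  then show ?thesis by (simp add: trajectory_def space_F)
qed

lemma trajectory_in_M: "trajectory k z \<in> sets M"
  using trajectory_in_F latent.subalg by (auto simp: subalgebra_def)

text \<open>The latent states are prescribed up to time \<open>k\<close> and the letters up to time \<open>m\<close>. For \<open>m = k - 1\<close>
  this is the information present when the chain has just entered its current state, which has
  not emitted yet; this is the situation described by \<^const>\<open>word_expectation\<close>.\<close>

definition history :: "nat \<Rightarrow> (nat \<Rightarrow> 's) \<Rightarrow> nat \<Rightarrow> (nat \<Rightarrow> 'a \<times> 'a) \<Rightarrow> 'w set" where
  "history k z m w = {\<omega> \<in> trajectory k z. \<forall>i\<in>{1..m}. W i \<omega> = w i}"

lemma W_event: "i \<ge> 1 \<Longrightarrow> {\<omega> \<in> space M. W i \<omega> \<in> B} \<in> sets M"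
  using measurable_sets[OF W_measurable, of i B] by (simp add: vimage_def Int_def conj_commute)

lemma history_in_M: "history k z m w \<in> sets M"
proof -
  have "{\<omega> \<in> space M. \<forall>i\<in>{1..m}. W i \<omega> = w i} \<in> sets M"
    by (intro sets.sets_Collect_finite_All) (use W_event[of _ "{w _}"] in auto)
  moreover have "history k z m w = trajectory k z \<inter> {\<omega> \<in> space M. \<forall>i\<in>{1..m}. W i \<omega> = w i}"
    by (auto simp: history_def trajectory_def)
  ultimately show ?thesis using trajectory_in_M by auto
qed

lemma emission_AE:
  assumes "i \<ge> 1"
  shows "AE \<omega> in M. cond_probability M F {\<omega> \<in> space M. W i \<omega> \<in> B} \<omega>
    = measure_pmf.prob (Q (Z i \<omega>)) B"
  using hmm assms by (simp add: hidden_markov_model_def W_def)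

text \<open>The defining property of conditional probability, for an event on which it is constant.\<close>

lemma prob_inter_latent:
  assumes "A \<in> sets F" "C \<in> sets M"
    and "AE \<omega> in M. \<omega> \<in> A \<longrightarrow> cond_probability M F C \<omega> = c"
  shows "prob (A \<inter> C) = prob A * c"
proof -
  have A: "A \<in> sets M" using assms(1) latent.subalg by (auto simp: subalgebra_def)
  have "prob (A \<inter> C) = (\<integral>\<omega>\<in>A. indicator C \<omega> \<partial>M)"
    using A assms(2) by (simp add: set_lebesgue_integral_def flip: indicator_inter_arith)
  also have "\<dots> = (\<integral>\<omega>\<in>A. real_cond_exp M F (indicator C) \<omega> \<partial>M)"
    using assms(1,2) by (intro latent.real_cond_exp_intA) (auto simp: less_top[symmetric])
  also have "\<dots> = (\<integral>\<omega>\<in>A. c \<partial>M)"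
    using assms(3) A
    by (intro set_lebesgue_integral_cong_AE) (auto simp: cond_probability_def)
  also have "\<dots> = prob A * c"
    using A by (simp add: set_lebesgue_integral_def)
  finally show ?thesis .
qed

text \<open>On a trajectory the conditional probability of a word given the latent chain is, by
  conditional independence, the constant product of the emission probabilities.\<close>

lemma prob_history:
  assumes "m \<le> k"
  shows "prob (history k z m w) = prob (trajectory k z) * (\<Prod>i\<in>{1..m}. pmf (Q (z i)) (w i))"
proof (cases "m = 0")
  case True
  then show ?thesis by (simp add: history_def)
next
  case False
  let ?C = "\<lambda>i. W i -` {w i} \<inter> space M"
  have history: "history k z m w = trajectory k z \<inter> (\<Inter>i\<in>{1..m}. ?C i)"
    using False by (auto simp: history_def trajectory_def)
  have "AE \<omega> in M. cond_probability M F (\<Inter>i\<in>{1..m}. ?C i) \<omega>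
      = (\<Prod>i\<in>{1..m}. cond_probability M F (?C i) \<omega>)"
  proof -
    have "cond_indep_vars M F (\<lambda>_. count_space UNIV) W {1..}"
      using hmm by (simp add: hidden_markov_model_def W_def[abs_def])
    then have "\<forall>J\<subseteq>{1..}. J \<noteq> {} \<longrightarrow> finite J \<longrightarrow> (\<forall>B\<in>(\<Pi> j\<in>J. sets (count_space UNIV)).
        AE \<omega> in M. cond_probability M F (\<Inter>j\<in>J. W j -` B j \<inter> space M) \<omega>
                    = (\<Prod>j\<in>J. cond_probability M F (W j -` B j \<inter> space M) \<omega>))"
      unfolding cond_indep_vars_def by blast
    from this[rule_format, of "{1..m}" "\<lambda>i. {w i}"] show ?thesis
      using False by auto
  qed
  moreover have "AE \<omega> in M. \<forall>i\<in>{1..m}. cond_probability M F (?C i) \<omega> = pmf (Q (Z i \<omega>)) (w i)"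
  proof (rule AE_finite_allI)
    fix i assume "i \<in> {1..m}"
    moreover have "?C i = {\<omega> \<in> space M. W i \<omega> \<in> {w i}}" by auto
    ultimately show "AE \<omega> in M. cond_probability M F (?C i) \<omega> = pmf (Q (Z i \<omega>)) (w i)"
      using emission_AE[of i "{w i}"] by (simp add: measure_pmf_single)
  qed auto
  ultimately have "AE \<omega> in M. \<omega> \<in> trajectory k z \<longrightarrow>
      cond_probability M F (\<Inter>i\<in>{1..m}. ?C i) \<omega> = (\<Prod>i\<in>{1..m}. pmf (Q (z i)) (w i))"
    by eventually_elim (use assms in \<open>auto simp: trajectory_def intro!: prod.cong\<close>)
  moreover have "(\<Inter>i\<in>{1..m}. ?C i) \<in> sets M"
    using False by (intro sets.finite_INT measurable_sets[OF W_measurable]) auto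
  ultimately show ?thesis
    unfolding history by (intro prob_inter_latent trajectory_in_F)
qed

lemma prob_trajectory_Suc:
  assumes "k \<ge> 1"
  shows "prob (trajectory (Suc k) z) = prob (trajectory k z) * P $ z k $ z (Suc k)"
proof (cases "prob (trajectory k z) > 0")
  case True
  have "trajectory (Suc k) z = {\<omega> \<in> space M. Z (Suc k) \<omega> = z (Suc k) \<and> (\<forall>i\<in>{1..k}. Z i \<omega> = z i)}"
    by (auto simp: trajectory_def atLeastAtMostSuc_conv)
  then have "prob (trajectory (Suc k) z) / prob (trajectory k z) = P $ z k $ z (Suc k)"
    using chain assms True by (auto simp: markov_chain_def cond_prob_def trajectory_def)
  then show ?thesis using True by (simp add: field_simps)
next
  case False
  have "prob (trajectory (Suc k) z) \<le> prob (trajectory k z)"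
    using trajectory_in_M by (intro finite_measure_mono) (auto simp: trajectory_def)
  moreover have "prob (trajectory k z) = 0" using False measure_nonneg[of M] by (metis less_eq_real_def)
  ultimately show ?thesis using measure_nonneg[of M "trajectory (Suc k) z"] by simp
qed

text \<open>One step of the model, emitting \<open>b\<close> and moving to \<open>t\<close>, multiplies the probability by the
  weight in the recursion of \<^const>\<open>word_expectation\<close>. Updating the prescribed sequences changes
  only the new entries.\<close>

lemma prob_history_Suc:
  "prob (history (Suc (Suc k)) (z(Suc (Suc k) := t)) (Suc k) (w(Suc k := b)))
    = prob (history (Suc k) z k w) * (pmf (Q (z (Suc k))) b * P $ z (Suc k) $ t)"
proof -
  have "trajectory (Suc k) (z(Suc (Suc k) := t)) = trajectory (Suc k) z"
    by (auto simp: trajectory_def)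
  moreover have "(\<Prod>i\<in>{1..k}. pmf (Q ((z(Suc (Suc k) := t)) i)) ((w(Suc k := b)) i))
      = (\<Prod>i\<in>{1..k}. pmf (Q (z i)) (w i))"
    by (intro prod.cong) auto
  ultimately show ?thesis
    by (simp add: prob_history prob_trajectory_Suc)
qed

definition letters_after :: "nat \<Rightarrow> nat \<Rightarrow> 'w \<Rightarrow> ('a \<times> 'a) list" where
  "letters_after k n \<omega> = map (\<lambda>i. W i \<omega>) [Suc k..<Suc (k + n)]"

lemma letters_after_0: "letters_after k 0 \<omega> = []"
  and letters_after_Suc: "letters_after k (Suc n) \<omega> = W (Suc k) \<omega> # letters_after (Suc k) n \<omega>"
  by (simp_all add: letters_after_def upt_rec[of "Suc k"] del: upt_Suc)

lemma letters_after_measurable: "letters_after k n \<in> measurable M (count_space UNIV)"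
proof (induction n arbitrary: k)
  case (Suc n)
  show ?case
    unfolding letters_after_Suc[abs_def]
    by (rule measurable_compose_countable[OF measurable_compose[OF Suc] W_measurable]) auto
qed (simp add: letters_after_0[abs_def])

lemma integrable_letters:
  fixes f :: "('a \<times> 'a) list \<Rightarrow> real"
  shows "integrable M (\<lambda>\<omega>. indicator (history j z m w) \<omega> * f (letters_after k n \<omega>))"
proof (rule integrable_const_bound)
  let ?L = "{ws :: ('a \<times> 'a) list. length ws = n}"
  let ?B = "Max ((\<lambda>ws. \<bar>f ws\<bar>) ` ?L)"
  have fin: "finite ?L" using finite_lists_length_eq[of "UNIV :: ('a \<times> 'a) set" n] by simp
  have B: "\<bar>f (letters_after k n \<omega>)\<bar> \<le> ?B" for \<omega>
    using fin by (intro Max_ge) (auto simp: letters_after_def)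
  then have "0 \<le> ?B" by (rule order_trans[OF abs_ge_zero])
  then show "AE \<omega> in M. norm (indicator (history j z m w) \<omega> * f (letters_after k n \<omega>)) \<le> ?B"
    using B by (intro always_eventually) (auto simp: indicator_def)
  show "(\<lambda>\<omega>. indicator (history j z m w) \<omega> * f (letters_after k n \<omega>)) \<in> borel_measurable M"
    using history_in_M measurable_compose[OF letters_after_measurable, of f borel]
    by (intro borel_measurable_times) auto
qed

lemma indicator_history_split:
  assumes "\<omega> \<in> space M"
  shows "indicator (history (Suc k) z k w) \<omega> * g (W (Suc k) \<omega>) =
    (\<Sum>b\<in>UNIV. \<Sum>t\<in>UNIV.
       indicator (history (Suc (Suc k)) (z(Suc (Suc k) := t)) (Suc k) (w(Suc k := b))) \<omega> * (g b :: real))"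
proof -
  let ?ind = "\<lambda>b t. indicator (history (Suc (Suc k)) (z(Suc (Suc k) := t)) (Suc k) (w(Suc k := b))) \<omega>"
  have split: "?ind b t * g b
     = (if b = W (Suc k) \<omega> then if t = Z (Suc (Suc k)) \<omega>
        then indicator (history (Suc k) z k w) \<omega> * g b else 0 else 0)" for b t
    using assms
    by (auto simp: indicator_def history_def trajectory_def atLeastAtMostSuc_conv split: if_splits)
  have "(\<Sum>t\<in>UNIV. ?ind b t * g b) =
      (if b = W (Suc k) \<omega> then indicator (history (Suc k) z k w) \<omega> * g b else 0)" for b
    unfolding split by (cases "b = W (Suc k) \<omega>") simp_all
  then show ?thesis by simp
qed

text \<open>Splitting a history according to the next letter and the next state reproduces the recursion
  of \<^const>\<open>word_expectation\<close>. The history is kept general because each step extends it.\<close>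

lemma expectation_after_history:
  "(\<integral>\<omega>. indicator (history (Suc k) z k w) \<omega> * f (letters_after k n \<omega>) \<partial>M)
    = prob (history (Suc k) z k w) * E n (z (Suc k)) f"
proof (induction n arbitrary: k z w f)
  case 0
  then show ?case using history_in_M by (simp add: letters_after_0)
next
  case (Suc n)
  let ?H = "\<lambda>b t. history (Suc (Suc k)) (z(Suc (Suc k) := t)) (Suc k) (w(Suc k := b))"
  have "(\<integral>\<omega>. indicator (history (Suc k) z k w) \<omega> * f (letters_after k (Suc n) \<omega>) \<partial>M)
      = (\<integral>\<omega>. (\<Sum>b\<in>UNIV. \<Sum>t\<in>UNIV. indicator (?H b t) \<omega> * f (b # letters_after (Suc k) n \<omega>)) \<partial>M)"
    unfolding letters_after_Suc
    by (intro Bochner_Integration.integral_cong refl indicator_history_split)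
  also have "\<dots> = (\<Sum>b\<in>UNIV. \<Sum>t\<in>UNIV.
      (\<integral>\<omega>. indicator (?H b t) \<omega> * f (b # letters_after (Suc k) n \<omega>) \<partial>M))"
  proof -
    have "integrable M (\<lambda>\<omega>. indicator (?H b t) \<omega> * f (b # letters_after (Suc k) n \<omega>))" for b t
      by (rule integrable_letters[of _ _ _ _ "\<lambda>ws. f (b # ws)"])
    then show ?thesis
      by (simp only: Bochner_Integration.integral_sum Bochner_Integration.integrable_sum)
  qed
  also have "\<dots> = (\<Sum>b\<in>UNIV. \<Sum>t\<in>UNIV. prob (?H b t) * E n t (\<lambda>ws. f (b # ws)))"
    by (simp only: Suc.IH[of "Suc k" _ _ "\<lambda>ws. f (_ # ws)"] fun_upd_same)
  also have "\<dots> = prob (history (Suc k) z k w) * E (Suc n) (z (Suc k)) f"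
    by (simp add: prob_history_Suc sum_distrib_left mult.assoc)
  finally show ?case .
qed

lemma expectation_letters:
  "expectation (\<lambda>\<omega>. f (letters_after 0 n \<omega>)) = (\<Sum>s\<in>UNIV. pmf \<mu> s * E n s f)"
proof -
  \<comment> \<open>At time \<open>1\<close> no letter is prescribed yet, so the sequence of letters is arbitrary.\<close>
  let ?H = "\<lambda>s. history (Suc 0) (\<lambda>_. s) 0 undefined"
  have H: "?H s = {\<omega> \<in> space M. Z 1 \<omega> = s}" for s
    by (auto simp: history_def trajectory_def)
  have "expectation (\<lambda>\<omega>. f (letters_after 0 n \<omega>))
      = (\<integral>\<omega>. (\<Sum>s\<in>UNIV. indicator (?H s) \<omega> * f (letters_after 0 n \<omega>)) \<partial>M)"
  proof (intro Bochner_Integration.integral_cong refl)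
    fix \<omega> assume "\<omega> \<in> space M"
    then have "indicator (?H s) \<omega> * f (letters_after 0 n \<omega>)
        = (if s = Z 1 \<omega> then f (letters_after 0 n \<omega>) else 0)" for s
      unfolding H by (auto simp: indicator_def)
    then show "f (letters_after 0 n \<omega>) = (\<Sum>s\<in>UNIV. indicator (?H s) \<omega> * f (letters_after 0 n \<omega>))"
      by simp
  qed
  also have "\<dots> = (\<Sum>s\<in>UNIV. prob (?H s) * E n s f)"
    by (simp only: integrable_letters Bochner_Integration.integral_sum expectation_after_history)
  also have "\<dots> = (\<Sum>s\<in>UNIV. pmf \<mu> s * E n s f)"
    using chain by (simp add: H markov_chain_def)
  finally show ?thesis .
qed

lemma emitting_state_exists:
  assumes "i \<ge> 1" and pos: "prob {\<omega> \<in> space M. W i \<omega> \<in> B} > 0"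
  shows "\<exists>s. \<exists>p\<in>B. pmf (Q s) p > 0"
proof (rule ccontr)
  assume none: "\<nexists>s. \<exists>p\<in>B. pmf (Q s) p > 0"
  have "measure_pmf.prob (Q s) B = 0" for s
    using none by (subst measure_pmf_zero_iff) (auto simp: set_pmf_iff pmf_positive_iff)
  then have "prob (space M \<inter> {\<omega> \<in> space M. W i \<omega> \<in> B}) = prob (space M) * 0"
    using emission_AE[OF assms(1), of B] W_event[OF assms(1)] sets.top[of F]
    by (intro prob_inter_latent) (auto simp: space_F)
  with pos show False by (simp add: Int_def)
qed

end

section \<open>Convergence of the normalised mean\<close>

theorem proposition2p1:
  fixes M :: "'w measure"
    and Z :: "nat \<Rightarrow> 'w \<Rightarrow> 's::finite"
    and X Y :: "nat \<Rightarrow> 'w \<Rightarrow> 'a::finite"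
    and \<mu> \<pi> :: "'s pmf"
    and P :: "real^'s^'s"
    and Q :: "'s \<Rightarrow> ('a \<times> 'a) pmf"
  assumes "prob_space M"
    and "hidden_markov_model M Z X Y \<mu> P Q"
    and "irreducible_matrix P"
    and "aperiodic_matrix P"
    and "stationary_distribution P \<pi>"
    and "\<exists>a. \<exists>i\<ge>1. \<exists>j\<ge>1. \<P>(\<omega> in M. X i \<omega> = a \<and> Y j \<omega> = a) > 0"
  shows "\<exists>\<gamma>::real. 0 < \<gamma> \<and> \<gamma> \<le> 1 \<and>
           (\<lambda>n. prob_space.expectation M (\<lambda>\<omega>. real (LC X Y n \<omega>)) / real n) \<longlonglongrightarrow> \<gamma>"
proof -
  interpret prob_space M by fact
  interpret hidden_markov M Z X Y \<mu> P Q by unfold_locales fact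
  interpret pair_emitting_chain P Q by unfold_locales fact
  obtain a i j where i: "i \<ge> 1" and j: "j \<ge> 1"
    and pos: "prob {\<omega> \<in> space M. X i \<omega> = a \<and> Y j \<omega> = a} > 0"
    using assms(6) by blast
  have "prob {\<omega> \<in> space M. X i \<omega> = a \<and> Y j \<omega> = a} \<le> prob {\<omega> \<in> space M. W i \<omega> \<in> {a} \<times> UNIV}"
    by (intro finite_measure_mono W_event i) (auto simp: W_def)
  then obtain s0 b where X: "pmf (Q s0) (a, b) > 0"
    using emitting_state_exists[OF i, of "{a} \<times> UNIV"] pos by auto
  have "prob {\<omega> \<in> space M. X i \<omega> = a \<and> Y j \<omega> = a} \<le> prob {\<omega> \<in> space M. W j \<omega> \<in> UNIV \<times> {a}}"
    by (intro finite_measure_mono W_event j) (auto simp: W_def)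
  then obtain t0 c where Y: "pmf (Q t0) (c, a) > 0"
    using emitting_state_exists[OF j, of "UNIV \<times> {a}"] pos by auto
  have "LC X Y n \<omega> = lcs (letters_after 0 n \<omega>)" for n \<omega>
    by (simp add: LC_eq_lcs letters_after_def W_def del: upt_Suc)
  then have "expectation (\<lambda>\<omega>. real (LC X Y n \<omega>)) = (\<Sum>s\<in>UNIV. pmf \<mu> s * mean_lcs s n)" for n
    using expectation_letters[of "\<lambda>ws. real (lcs ws)" n] by (simp add: mean_lcs_def)
  then show ?thesis
    using mean_lcs_rate[OF X Y] by (simp only:) blast
qed

end
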